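(* Let $\mathcal{L}=(L,\vee,\wedge,{}',0,1)$ be an orthomodular lattice and define binary operations $\odot$ and $\rightarrow$ on $L$ by $$x\odot y=(x\vee y')\wedge y,\qquad x\rightarrow y=(y\wedge x)\vee x'$$ for all $x,y\in L$. Then $\mathbf{A}(\mathcal{L})=(L,\vee,\wedge,\odot,\rightarrow,0,1)$ is a left residuated l-groupoid satisfying divisibility, antitony, the double negation law, as well as the identity $$x\odot(x\vee y)=x \quad\text{for all } x,y\in L.$$ Moreover, $x'=x\rightarrow 0$ for all $x\in L$.
   Context: An orthomodular lattice is an algebra $(L,\vee,\wedge,{}',0,1)$ of type $(2,2,1,0,0)$ such that for all $x,y\in L$: (i) $(L,\vee,\wedge,0,1)$ is a bounded lattice (with least element $0$ and greatest element $1$); (ii) $x\vee x'=1$; (iii) $x\le y$ implies $y'\le x'$; (iv) $(x')'=x$; (v) $x\le y$ implies $y=x\vee(y\wedge x')$. A left residuated l-groupoid is an algebra $(A,\vee,\wedge,\odot,\rightarrow,0,1)$ of type $(2,2,2,2,0,0)$ such that for all $x,y,z\in A$: (i) $(A,\vee,\wedge,0,1)$ is a bounded lattice; (ii) $x\odot 1=1\odot x=x$; (iii) $x\odot y\le z$ if and only if $x\le y\rightarrow z$. (Neither associativity nor commutativity of $\odot$ is assumed.) In a left residuated l-groupoid, write $\neg x:=x\rightarrow 0$. It satisfies divisibility if $(x\rightarrow y)\odot x=x\wedge y$ for all $x,y$; antitony if $x\le y$ implies $\neg y\le\neg x$ for all $x,y$; and the double negation law if $\neg(\neg x)=x$ for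 all $x$. *)

theory Defs
  imports "HOL-Library.Complemented_Lattices"
begin

text \<open>
  Orthomodular lattices are the library class \<^class>\<open>orthomodular_lattice\<close>, with
  \<^const>\<open>uminus\<close> as orthocomplementation. That class also carries a derived difference operation
  and assumes \<open>x \<sqinter> - x = \<bottom>\<close>. The latter is redundant: the axioms below, without it, already yield an
  instance of the class.
\<close>

lemma orthomodular_latticeI:
  fixes inf sup :: "'a \<Rightarrow> 'a \<Rightarrow> 'a" and less_eq less :: "'a \<Rightarrow> 'a \<Rightarrow> bool"
    and bot top :: 'a and compl :: "'a \<Rightarrow> 'a"
  assumes lattice: "class.bounded_lattice inf less_eq less sup bot top"
    and sup_compl: "\<And>x. sup x (compl x) = top"
    and antimono: "\<And>x y. less_eq x y \<Longrightarrow> less_eq (compl y) (compl x)"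
    and involution: "\<And>x. compl (compl x) = x"
    and orthomodular: "\<And>x y. less_eq x y \<Longrightarrow> y = sup x (inf y (compl x))"
  shows "class.orthomodular_lattice (\<lambda>x y. inf x (compl y)) compl inf less_eq less sup bot top"
proof -
  interpret bounded_lattice inf less_eq less sup bot top by (fact lattice)
  have inf_compl: "inf x (compl x) = bot" for x
  proof (rule order.antisym)
    let ?m = "inf x (compl x)"
    have "less_eq x (compl ?m)" "less_eq (compl x) (compl ?m)"
      using antimono[of ?m "compl x"] antimono[of ?m x] by (simp_all add: involution)
    then have "less_eq (sup x (compl x)) (compl ?m)" by simp
    then have "compl ?m = top" by (simp add: sup_compl top_unique)
    then have "?m = compl top" by (metis involution)
    moreover have "less_eq (compl top) bot"
      using antimono[of "compl bot" top] by (simp add: involution)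
    ultimately show "less_eq ?m bot" by simp
  qed simp
  show ?thesis
  proof unfold_locales
    show "sup x (inf (compl x) y) = y" if "less_eq x y" for x y
      using orthomodular[OF that] by (simp add: inf_commute)
  qed (simp_all add: inf_compl sup_compl involution antimono)
qed

locale left_residuated_l_groupoid =
  bounded_lattice inf less_eq less sup bot top
  for inf :: "'a \<Rightarrow> 'a \<Rightarrow> 'a" (infixl "\<sqinter>" 70)
    and less_eq :: "'a \<Rightarrow> 'a \<Rightarrow> bool" (infix "\<sqsubseteq>" 50)
    and less :: "'a \<Rightarrow> 'a \<Rightarrow> bool" (infix "\<sqsubset>" 50)
    and sup :: "'a \<Rightarrow> 'a \<Rightarrow> 'a" (infixl "\<squnion>" 65)
    and bot :: 'a ("\<bottom>")
    and top :: 'a ("\<top>") +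
  fixes mult :: "'a \<Rightarrow> 'a \<Rightarrow> 'a" (infixl "\<odot>" 70)
    and imp :: "'a \<Rightarrow> 'a \<Rightarrow> 'a" (infixr "\<rightarrow>" 60)
  assumes mult_top: "x \<odot> \<top> = x"
    and top_mult: "\<top> \<odot> x = x"
    and residuation: "x \<odot> y \<sqsubseteq> z \<longleftrightarrow> x \<sqsubseteq> y \<rightarrow> z"
begin

definition neg :: "'a \<Rightarrow> 'a"
  where "neg x = x \<rightarrow> \<bottom>"

definition divisibility :: bool
  where "divisibility \<longleftrightarrow> (\<forall>x y. (x \<rightarrow> y) \<odot> x = x \<sqinter> y)"

definition antitony :: bool
  where "antitony \<longleftrightarrow> (\<forall>x y. x \<sqsubseteq> y \<longrightarrow> neg y \<sqsubseteq> neg x)"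

definition double_negation_law :: bool
  where "double_negation_law \<longleftrightarrow> (\<forall>x. neg (neg x) = x)"

end

definition sasaki_mult :: "'a \<Rightarrow> 'a \<Rightarrow> 'a::orthomodular_lattice" (infixl "\<odot>\<^sub>S" 70)
  where "x \<odot>\<^sub>S y = inf (sup x (- y)) y"

definition sasaki_imp :: "'a \<Rightarrow> 'a \<Rightarrow> 'a::orthomodular_lattice" (infixr "\<rightarrow>\<^sub>S" 60)
  where "x \<rightarrow>\<^sub>S y = sup (inf y x) (- x)"

end

theory Submission
  imports Defs
begin

text \<open>
  Write \<open>\<squnion>\<close>, \<open>\<sqinter>\<close> for the lattice operations. If \<open>a\<close> lies below \<open>y\<close>, the orthomodular law in its
  dual form says \<open>(a \<squnion> - y) \<sqinter> y = a\<close>, and if \<open>b\<close> lies above \<open>- y\<close>, the law itself says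
  \<open>(b \<sqinter> y) \<squnion> - y = b\<close>. Hence \<open>b \<mapsto> b \<sqinter> y\<close> and \<open>a \<mapsto> a \<squnion> - y\<close> are mutually inverse monotone maps
  between the elements above \<open>- y\<close> and those below \<open>y\<close>. Now \<open>x \<odot>\<^sub>S y\<close> raises \<open>x\<close> to \<open>x \<squnion> - y\<close> and
  then applies the first map, while \<open>y \<rightarrow>\<^sub>S z\<close> lowers \<open>z\<close> to \<open>z \<sqinter> y\<close> and then applies the second,
  so that both \<open>x \<odot>\<^sub>S y \<le> z\<close> and \<open>x \<le> y \<rightarrow>\<^sub>S z\<close> amount to \<open>x \<squnion> - y \<le> (z \<sqinter> y) \<squnion> - y\<close>. Divisibility
  and \<open>x \<odot>\<^sub>S (x \<squnion> y) = x\<close> are instances of the dual law, and the negation of the groupoid is the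
  orthocomplementation, whence antitony and the double negation law.
\<close>

lemma orthomodular_inf_sup_compl:
  fixes a y :: "'a::orthomodular_lattice"
  assumes "a \<le> y"
  shows "inf (sup a (- y)) y = a"
proof -
  have "sup (- y) (inf y (- a)) = - a"
    using orthomodular[of "- y" "- a"] assms by simp
  then have "- sup (- y) (inf y (- a)) = a"
    by simp
  then show ?thesis
    by (simp add: inf_commute sup_commute)
qed

lemma orthomodular_sup_inf_compl:
  fixes b y :: "'a::orthomodular_lattice"
  assumes "- y \<le> b"
  shows "sup (inf b y) (- y) = b"
  using orthomodular[OF assms] by (simp add: inf_commute sup_commute)

lemma sasaki_residuation:
  fixes x y z :: "'a::orthomodular_lattice"
  shows "x \<odot>\<^sub>S y \<le> z \<longleftrightarrow> x \<le> y \<rightarrow>\<^sub>S z"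
proof
  assume "x \<odot>\<^sub>S y \<le> z"
  then have "inf (sup x (- y)) y \<le> inf z y"
    by (simp add: sasaki_mult_def)
  then have "sup (inf (sup x (- y)) y) (- y) \<le> sup (inf z y) (- y)"
    by (rule sup_mono) simp
  then show "x \<le> y \<rightarrow>\<^sub>S z"
    by (simp add: orthomodular_sup_inf_compl sasaki_imp_def)
next
  assume "x \<le> y \<rightarrow>\<^sub>S z"
  then have "sup x (- y) \<le> sup (inf z y) (- y)"
    by (simp add: sasaki_imp_def)
  then have "inf (sup x (- y)) y \<le> inf (sup (inf z y) (- y)) y"
    by (rule inf_mono) simp
  then show "x \<odot>\<^sub>S y \<le> z"
    by (simp add: orthomodular_inf_sup_compl sasaki_mult_def)
qed

lemma sasaki_imp_bot: "x \<rightarrow>\<^sub>S bot = - x"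
  by (simp add: sasaki_imp_def)

lemma sasaki_divisibility: "(x \<rightarrow>\<^sub>S y) \<odot>\<^sub>S x = inf x y"
  using orthomodular_inf_sup_compl[of "inf y x" x]
  by (simp add: sasaki_imp_def sasaki_mult_def sup_assoc inf_commute)

lemma sasaki_mult_absorb:
  assumes "x \<le> y"
  shows "x \<odot>\<^sub>S y = x"
  using assms by (simp add: sasaki_mult_def orthomodular_inf_sup_compl)

theorem theorem6:
  shows "left_residuated_l_groupoid inf less_eq less sup bot top
      ((\<odot>\<^sub>S) :: 'a \<Rightarrow> 'a \<Rightarrow> 'a::orthomodular_lattice) (\<rightarrow>\<^sub>S)
    \<and> left_residuated_l_groupoid.divisibility inf
      ((\<odot>\<^sub>S) :: 'a \<Rightarrow> 'a \<Rightarrow> 'a) (\<rightarrow>\<^sub>S)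
    \<and> left_residuated_l_groupoid.antitony less_eq bot
      ((\<rightarrow>\<^sub>S) :: 'a \<Rightarrow> 'a \<Rightarrow> 'a)
    \<and> left_residuated_l_groupoid.double_negation_law bot
      ((\<rightarrow>\<^sub>S) :: 'a \<Rightarrow> 'a \<Rightarrow> 'a)
    \<and> (\<forall>x y :: 'a. x \<odot>\<^sub>S sup x y = x)
    \<and> (\<forall>x :: 'a. - x = x \<rightarrow>\<^sub>S bot)"
proof -
  interpret left_residuated_l_groupoid inf less_eq less sup bot top
    "(\<odot>\<^sub>S) :: 'a \<Rightarrow> 'a \<Rightarrow> 'a" "(\<rightarrow>\<^sub>S)"
  proof
    show "x \<odot>\<^sub>S top = x" and "top \<odot>\<^sub>S x = x" for x :: 'a
      by (simp_all add: sasaki_mult_def)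
  qed (rule sasaki_residuation)
  have neg_eq_compl: "neg x = - x" for x
    by (simp add: neg_def sasaki_imp_bot)
  have divisibility
    by (simp add: divisibility_def sasaki_divisibility)
  moreover have antitony and double_negation_law
    by (simp_all add: antitony_def double_negation_law_def neg_eq_compl)
  ultimately show ?thesis
    by (simp add: left_residuated_l_groupoid_axioms sasaki_mult_absorb sasaki_imp_bot)
qed

end
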